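(* Let $D:\mathbb{N}\to[1,\infty)$ be a function such that for every $m\in\mathbb{N}$, every $N\in\mathbb{N}$ and every $m$-homogeneous polynomial $P(z)=\sum_{|\alpha|=m}a_\alpha z^\alpha$ on $\mathbb{C}^N$ with complex coefficients, $$\left(\sum_{|\alpha|=m}|a_\alpha|^{\frac{2m}{m+1}}\right)^{\frac{m+1}{2m}}\le D(m)\,\sup_{z\in\mathbb{D}^N}|P(z)|.$$ Then for every integer $m\ge 2$, $$D(m)\ \ge\ \frac{\left(2+2^{m}\right)^{\frac{m+1}{2m}}}{\sqrt{4+2^{m+1}}}\ >\ 1.$$
   Context: Here $\mathbb{N}=\{1,2,3,\dots\}$ and $\mathbb{D}^N=\{z\in\mathbb{C}^N:\ |z_i|\le 1 \text{ for } i=1,\dots,N\}$ is the unit polydisc. For a multi-index $\alpha=(\alpha_1,\dots,\alpha_N)$ of nonnegative integers, $|\alpha|=\alpha_1+\cdots+\alpha_N$ and $z^\alpha=z_1^{\alpha_1}\cdots z_N^{\alpha_N}$. The displayed inequality satisfied by $D$ is the Bohnenblust--Hille inequality for complex homogeneous polynomials; $D(m)$ does not depend on $N$ or $P$. In particular the statement applies when $D(m)$ is the optimal (smallest) constant for which the inequality holds for all $N$ and all $m$-homogeneous $P$ on $\mathbb{C}^N$. *)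

theory Defs
  imports Complex_Main "HOL-Library.FuncSet"
begin

text \<open>
  The dimension \<open>N\<close> is quantified inside the statement, so the coordinates are indexed by
  \<open>{..<N}\<close>.  Multi-indices vanish outside \<open>{..<N}\<close>, so that each monomial is represented by
  exactly one multi-index; points of \<open>\<complex>\<^sup>N\<close> are extensional functions on \<open>{..<N}\<close>.
\<close>

definition multi_indices :: "nat \<Rightarrow> nat \<Rightarrow> (nat \<Rightarrow> nat) set" where
  "multi_indices N m = {\<alpha>. (\<forall>i\<ge>N. \<alpha> i = 0) \<and> (\<Sum>i<N. \<alpha> i) = m}"

definition monomial :: "nat \<Rightarrow> (nat \<Rightarrow> nat) \<Rightarrow> (nat \<Rightarrow> complex) \<Rightarrow> complex" where
  "monomial N \<alpha> z = (\<Prod>i<N. z i ^ \<alpha> i)"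

text \<open>
  An \<open>m\<close>-homogeneous polynomial on \<open>\<complex>\<^sup>N\<close> is given by its coefficient family \<open>a\<close>, of which only
  the values on \<^term>\<open>multi_indices N m\<close> matter.
\<close>

definition hom_poly ::
    "nat \<Rightarrow> nat \<Rightarrow> ((nat \<Rightarrow> nat) \<Rightarrow> complex) \<Rightarrow> (nat \<Rightarrow> complex) \<Rightarrow> complex" where
  "hom_poly N m a z = (\<Sum>\<alpha>\<in>multi_indices N m. a \<alpha> * monomial N \<alpha> z)"

definition polydisc :: "nat \<Rightarrow> (nat \<Rightarrow> complex) set" where
  "polydisc N = {..<N} \<rightarrow>\<^sub>E {w. norm w \<le> 1}"

text \<open>
  The sums above range over a finite set, and the supremum of \<^term>\<open>\<lambda>z. norm (hom_poly N m a z)\<close>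
  over the polydisc is that of a nonempty bounded set of reals; so neither takes a default value.
\<close>

lemma finite_multi_indices: "finite (multi_indices N m)"
proof (rule finite_subset)
  show "multi_indices N m
      \<subseteq> {\<alpha>. \<forall>i. (i \<in> {..<N} \<longrightarrow> \<alpha> i \<in> {..m}) \<and> (i \<notin> {..<N} \<longrightarrow> \<alpha> i = 0)}"
    by (auto simp: multi_indices_def intro: member_le_sum)
  show "finite {\<alpha>. \<forall>i. (i \<in> {..<N} \<longrightarrow> \<alpha> i \<in> {..m}) \<and> (i \<notin> {..<N} \<longrightarrow> \<alpha> i = (0::nat))}"
    by (rule finite_set_of_finite_funs) auto
qed

lemma polydisc_nonempty: "polydisc N \<noteq> {}"
  unfolding polydisc_def PiE_eq_empty_iff by (auto intro: exI[of _ 0])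

lemma bdd_above_hom_poly: "bdd_above ((\<lambda>z. norm (hom_poly N m a z)) ` polydisc N)"
proof (rule bdd_aboveI2)
  fix z assume z: "z \<in> polydisc N"
  have "norm (monomial N \<alpha> z) \<le> 1" for \<alpha>
    unfolding monomial_def prod_norm[symmetric] using z
    by (auto simp: polydisc_def PiE_iff norm_power intro!: prod_le_1 power_le_one)
  then show "norm (hom_poly N m a z) \<le> (\<Sum>\<alpha>\<in>multi_indices N m. norm (a \<alpha>))"
    unfolding hom_poly_def
    by (intro sum_norm_le) (simp add: norm_mult mult_left_le)
qed

end

theory Submission
  imports Defs
begin

text \<open>
  Up to a monomial factor, the inequality is tested on a quadratic form in two variables:
  the test polynomial is
  \<^term>\<open>\<lambda>z. z 2 ^ (m - 2) * (z 0 ^ 2 - z 1 ^ 2 + of_real c * z 0 * z 1)\<close>.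
  On the torus the quadratic factor has modulus \<open>\<bar>u - 1/u + c\<bar>\<close> with \<open>u = z 0 / z 1\<close>, and
  \<open>u - 1/u\<close> is purely imaginary of modulus at most \<open>2\<close>; thus the opposite signs of the squares
  force \<open>2\<close> and \<open>c\<close> to add up in quadrature, and the supremum is at most \<open>sqrt (4 + c\<^sup>2)\<close>
  (\<open>norm_test_quadratic_le\<close> gives this on the whole bidisc, without the maximum principle).
  The choice \<open>c = 2 powr ((m + 1) / 2)\<close> turns \<open>c powr (2 m / (m + 1))\<close> into \<open>2 ^ m\<close>
  and \<open>c\<^sup>2\<close> into \<open>2 ^ (m + 1)\<close>, which gives the stated quotient.
  The power of the third variable only raises the degree from \<open>2\<close> to \<open>m\<close>, so that no
  distinction between even and odd \<open>m\<close> arises.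

  The quotient exceeds \<open>1\<close> because \<open>4 + 2 ^ (m + 1)\<close> is \<open>2\<close> times \<open>2 + 2 ^ m\<close>:
  after squaring, the claim is that the \<open>m\<close>-th root of \<open>2 + 2 ^ m\<close> is larger than \<open>2\<close>.
\<close>

text \<open>
  With \<open>x = Re (z * cnj w)\<close> and \<open>r, s\<close> the squared moduli of \<open>z, w\<close>, the squared norm is
  \<open>(r + s)\<^sup>2 - 4 x\<^sup>2 + c\<^sup>2 r s + 2 c (r - s) x\<close>. Completing the square in \<open>x\<close> bounds it by
  \<open>(r + s)\<^sup>2 (4 + c\<^sup>2) / 4\<close>, and \<open>r + s \<le> 2\<close>.
\<close>

lemma norm_test_quadratic_le:
  fixes z w :: complex and c :: real
  assumes "norm z \<le> 1" "norm w \<le> 1"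
  shows "norm (z\<^sup>2 - w\<^sup>2 + of_real c * z * w) \<le> sqrt (4 + c\<^sup>2)"
proof (rule real_le_rsqrt)
  define r s x where "r = (norm z)\<^sup>2" and "s = (norm w)\<^sup>2" and "x = Re (z * cnj w)"
  have rs: "0 \<le> r" "0 \<le> s" "r \<le> 1" "s \<le> 1"
    using assms by (auto simp: r_def s_def power_le_one)
  have "(norm (z\<^sup>2 - w\<^sup>2 + of_real c * z * w))\<^sup>2
      = (r + s)\<^sup>2 - 4 * x\<^sup>2 + c\<^sup>2 * (r * s) + 2 * c * (r - s) * x"
    unfolding r_def s_def x_def cmod_power2 by (simp add: power2_eq_square) algebra
  also have "\<dots> = (r + s)\<^sup>2 * ((4 + c\<^sup>2) / 4) - (2 * x - c * (r - s) / 2)\<^sup>2"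
    by (simp add: power2_eq_square field_simps)
  also have "\<dots> \<le> (r + s)\<^sup>2 * ((4 + c\<^sup>2) / 4)"
    by simp
  also have "\<dots> \<le> 2\<^sup>2 * ((4 + c\<^sup>2) / 4)"
    using rs by (intro mult_right_mono power_mono) auto
  finally show "(norm (z\<^sup>2 - w\<^sup>2 + of_real c * z * w))\<^sup>2 \<le> 4 + c\<^sup>2"
    by simp
qed

definition ternary_index :: "nat \<Rightarrow> nat \<Rightarrow> nat \<Rightarrow> nat \<Rightarrow> nat" where
  "ternary_index i j k = (\<lambda>_. 0)(0 := i, 1 := j, 2 := k)"

lemma ternary_index_in_multi_indices:
  "ternary_index i j k \<in> multi_indices 3 (i + j + k)"
  by (auto simp: ternary_index_def multi_indices_def eval_nat_numeral)

lemma monomial_ternary_index: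
  "monomial 3 (ternary_index i j k) z = z 0 ^ i * z 1 ^ j * z 2 ^ k"
  by (simp add: ternary_index_def monomial_def eval_nat_numeral)

lemma ternary_index_eq_iff:
  "ternary_index i j k = ternary_index i' j' k' \<longleftrightarrow> i = i' \<and> j = j' \<and> k = k'"
proof
  assume eq: "ternary_index i j k = ternary_index i' j' k'"
  show "i = i' \<and> j = j' \<and> k = k'"
    using fun_cong[OF eq, of 0] fun_cong[OF eq, of 1] fun_cong[OF eq, of 2]
    by (simp add: ternary_index_def)
qed auto

definition test_coeff :: "nat \<Rightarrow> real \<Rightarrow> (nat \<Rightarrow> nat) \<Rightarrow> complex" where
  "test_coeff m c = (\<lambda>_. 0)
     (ternary_index 2 0 (m - 2) := 1,
      ternary_index 0 2 (m - 2) := -1,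
      ternary_index 1 1 (m - 2) := of_real c)"

lemma sum_test_coeff:
  fixes F :: "(nat \<Rightarrow> nat) \<Rightarrow> complex \<Rightarrow> 'b :: comm_monoid_add"
  assumes "m \<ge> 2" and F0: "\<And>\<alpha>. F \<alpha> 0 = 0"
  shows "(\<Sum>\<alpha>\<in>multi_indices 3 m. F \<alpha> (test_coeff m c \<alpha>))
    = F (ternary_index 2 0 (m - 2)) 1 + F (ternary_index 0 2 (m - 2)) (-1)
      + F (ternary_index 1 1 (m - 2)) (of_real c)"
proof -
  let ?S = "{ternary_index 2 0 (m - 2), ternary_index 0 2 (m - 2), ternary_index 1 1 (m - 2)}"
  have "(\<Sum>\<alpha>\<in>multi_indices 3 m. F \<alpha> (test_coeff m c \<alpha>)) = (\<Sum>\<alpha>\<in>?S. F \<alpha> (test_coeff m c \<alpha>))"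
  proof (rule sum.mono_neutral_right)
    show "?S \<subseteq> multi_indices 3 m"
      using ternary_index_in_multi_indices[of 2 0 "m - 2"]
        ternary_index_in_multi_indices[of 0 2 "m - 2"]
        ternary_index_in_multi_indices[of 1 1 "m - 2"]
        le_add_diff_inverse[OF \<open>m \<ge> 2\<close>]
      by simp
  qed (auto simp: finite_multi_indices test_coeff_def F0)
  also have "\<dots> = F (ternary_index 2 0 (m - 2)) 1 + F (ternary_index 0 2 (m - 2)) (-1)
      + F (ternary_index 1 1 (m - 2)) (of_real c)"
    by (simp add: test_coeff_def ternary_index_eq_iff add.assoc)
  finally show ?thesis .
qed

lemma hom_poly_test_coeff:
  assumes "m \<ge> 2"
  shows "hom_poly 3 m (test_coeff m c) z
    = z 2 ^ (m - 2) * ((z 0)\<^sup>2 - (z 1)\<^sup>2 + of_real c * z 0 * z 1)"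
  unfolding hom_poly_def using assms
  by (subst sum_test_coeff) (auto simp: monomial_ternary_index algebra_simps)

lemma SUP_norm_test_poly_le:
  assumes "m \<ge> 2"
  shows "(SUP z\<in>polydisc 3. norm (hom_poly 3 m (test_coeff m c) z)) \<le> sqrt (4 + c\<^sup>2)"
proof (rule cSUP_least)
  fix z assume "z \<in> polydisc 3"
  then have z: "norm (z 0) \<le> 1" "norm (z 1) \<le> 1" "norm (z 2) \<le> 1"
    by (auto simp: polydisc_def PiE_iff)
  have "norm (z 2) ^ (m - 2) * norm ((z 0)\<^sup>2 - (z 1)\<^sup>2 + of_real c * z 0 * z 1)
      \<le> 1 * sqrt (4 + c\<^sup>2)"
    using z norm_test_quadratic_le[OF z(1,2), of c] by (intro mult_mono power_le_one) auto
  then show "norm (hom_poly 3 m (test_coeff m c) z) \<le> sqrt (4 + c\<^sup>2)"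
    using assms by (simp add: hom_poly_test_coeff norm_mult norm_power)
qed (rule polydisc_nonempty)

lemma powr_quotient_gt_1:
  fixes m :: nat
  assumes "m \<ge> 1"
  shows "(2 + 2 ^ m) powr ((real m + 1) / (2 * real m)) / sqrt (4 + 2 ^ (m + 1)) > 1"
proof -
  let ?X = "2 + 2 ^ m :: real"
  have X: "?X > 0"
    by (simp add: add_pos_pos)
  have "sqrt (4 + 2 ^ (m + 1)) = sqrt ?X * sqrt 2"
    by (simp add: real_sqrt_mult[symmetric])
  also have "sqrt 2 = (2 ^ m :: real) powr (1 / (2 * real m))"
    using assms by (simp add: powr_realpow[symmetric] powr_powr powr_half_sqrt)
  also have "sqrt ?X * \<dots> < sqrt ?X * ?X powr (1 / (2 * real m))"
    using assms X by (intro mult_strict_left_mono powr_less_mono2) auto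
  also have "\<dots> = ?X powr (1 / 2 + 1 / (2 * real m))"
    using X by (simp add: powr_add powr_half_sqrt)
  also have "1 / 2 + 1 / (2 * real m) = (real m + 1) / (2 * real m)"
    using assms by (simp add: field_simps)
  finally have "sqrt (4 + 2 ^ (m + 1)) < ?X powr ((real m + 1) / (2 * real m))" .
  moreover have "sqrt (4 + 2 ^ (m + 1) :: real) > 0"
    by (simp add: add_pos_pos)
  ultimately show ?thesis
    by (simp only: less_divide_eq_1_pos)
qed

theorem theorem2p1:
  fixes D :: "nat \<Rightarrow> real"
  assumes D_ge_1: "\<And>m. m \<ge> 1 \<Longrightarrow> D m \<ge> 1"
    and BH: "\<And>m N a. m \<ge> 1 \<Longrightarrow> N \<ge> 1 \<Longrightarrow>
      (\<Sum>\<alpha>\<in>multi_indices N m. norm (a \<alpha>) powr (2 * real m / (real m + 1)))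
        powr ((real m + 1) / (2 * real m))
      \<le> D m * (SUP z\<in>polydisc N. norm (hom_poly N m a z))"
  shows "\<forall>m\<ge>2.
      D m \<ge> (2 + 2 ^ m) powr ((real m + 1) / (2 * real m)) / sqrt (4 + 2 ^ (m + 1)) \<and>
      (2 + 2 ^ m) powr ((real m + 1) / (2 * real m)) / sqrt (4 + 2 ^ (m + 1)) > 1"
proof (intro allI impI conjI)
  fix m :: nat assume m: "m \<ge> 2"
  define c :: real where "c = 2 powr ((real m + 1) / 2)"
  have c_pos: "c > 0"
    by (simp add: c_def)
  have "c\<^sup>2 = c powr 2"
    using c_pos by simp
  also have "\<dots> = 2 powr real (m + 1)"
    by (simp add: c_def powr_powr add_divide_distrib add.commute)
  finally have c_sq: "c\<^sup>2 = 2 ^ (m + 1)"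
    by (subst (asm) powr_realpow) auto
  have "(real m + 1) / 2 * (2 * real m / (real m + 1)) = real m"
    using add_pos_nonneg[of 1 "real m"] by (simp add: divide_simps)
  then have "c powr (2 * real m / (real m + 1)) = 2 powr real m"
    by (simp only: c_def powr_powr)
  then have c_powr: "c powr (2 * real m / (real m + 1)) = 2 ^ m"
    by (simp add: powr_realpow)
  have "(\<Sum>\<alpha>\<in>multi_indices 3 m. norm (test_coeff m c \<alpha>) powr (2 * real m / (real m + 1)))
      = 2 + 2 ^ m"
    using m c_pos
      sum_test_coeff[where F = "\<lambda>_ w. norm w powr (2 * real m / (real m + 1))" and c = c, OF m]
    by (simp add: c_powr)
  then have "(2 + 2 ^ m) powr ((real m + 1) / (2 * real m))
      \<le> D m * (SUP z\<in>polydisc 3. norm (hom_poly 3 m (test_coeff m c) z))"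
    using BH[of m 3 "test_coeff m c"] m by simp
  also have "\<dots> \<le> D m * sqrt (4 + 2 ^ (m + 1))"
    using SUP_norm_test_poly_le[OF m, of c] D_ge_1[of m] m
    by (intro mult_left_mono) (auto simp: c_sq)
  finally have "(2 + 2 ^ m) powr ((real m + 1) / (2 * real m)) \<le> D m * sqrt (4 + 2 ^ (m + 1))" .
  moreover have "sqrt (4 + 2 ^ (m + 1) :: real) > 0"
    by (simp add: add_pos_pos)
  ultimately show "D m \<ge> (2 + 2 ^ m) powr ((real m + 1) / (2 * real m)) / sqrt (4 + 2 ^ (m + 1))"
    by (simp only: pos_divide_le_eq)
  show "(2 + 2 ^ m) powr ((real m + 1) / (2 * real m)) / sqrt (4 + 2 ^ (m + 1)) > 1"
    using m by (intro powr_quotient_gt_1) simp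
qed

end
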